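(* Let $n\ge 1$ and, for normalized pure states $|\psi\rangle_{ABCS}\in\mathbb{C}^2\otimes\mathbb{C}^2\otimes\mathbb{C}^2\otimes\mathbb{C}^n$, let $$\tau_4(|\psi\rangle_{ABCS})=\sqrt{\tau_a^2(\rho_{ABC})-\tau_3^2(\rho_{ABC})},\qquad \rho_{ABC}=\mathrm{Tr}_S|\psi\rangle_{ABCS}\langle\psi|.$$ Then $\tau_4$ is a quadripartite entanglement monotone, i.e. it does not increase on average under stochastic local operations and classical communication among $A,B,C,S$: whenever such a protocol transforms $|\psi\rangle_{ABCS}$ into the ensemble $\{N_k,|\psi_k\rangle_{ABCS}\}$ (pure state $|\psi_k\rangle$ with probability $N_k$), one has $$\sum_k N_k\,\tau_4(|\psi_k\rangle_{ABCS})\le \tau_4(|\psi\rangle_{ABCS}).$$ Moreover, $\tau_4$ is a quadripartite entanglement measure in the sense that $\tau_4(|\psi\rangle_{ABCS})=0$ whenever $|\psi\rangle_{ABCS}$ is separable, i.e. is a product state with respect to some bipartition of the four parties $A,B,C,S$ into two nonempty groups.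
   Context: Parties $A,B,C$ hold qubits and $S$ holds an $n$-dimensional system. Three-tangle of pure states: for a three-qubit pure state $|\psi\rangle=\sum_{i,j,k=0}^1 a_{ijk}|ijk\rangle$ let $\mu_3(|\psi\rangle)=4|d_1-2d_2+4d_3|$, where $d_1=a_{000}^2a_{111}^2+a_{001}^2a_{110}^2+a_{010}^2a_{101}^2+a_{100}^2a_{011}^2$, $d_2=a_{000}a_{111}a_{011}a_{100}+a_{000}a_{111}a_{101}a_{010}+a_{000}a_{111}a_{110}a_{001}+a_{011}a_{100}a_{101}a_{010}+a_{011}a_{100}a_{110}a_{001}+a_{101}a_{010}a_{110}a_{001}$, $d_3=a_{000}a_{110}a_{101}a_{011}+a_{111}a_{001}a_{010}a_{100}$. Set $\tau_3(|\psi\rangle)=\sqrt{\mu_3(|\psi\rangle)}$. Mixed states: for a three-qubit density matrix $\rho$, $\tau_3(\rho)=\min_{\{p_i,\pi_i\}}\sum_i p_i\tau_3(\pi_i)$ and the 3-tangle of assistance is $\tau_a(\rho)=\max_{\{p_i,\pi_i\}}\sum_i p_i\tau_3(\pi_i)$, where the min and max run over all finite decompositions $\rho=\sum_i p_i\pi_i$ with $p_i\ge 0$, $\sum_i p_i=1$, and $\pi_i$ (projectors onto) normalized pure states. In particular $\tau_a(\rho)\ge\tau_3(\rho)$. Stochastic local operations and classical communication: a finite sequence of steps; in each step one of the parties performs on its own system a measurement given by finitely many Kraus operators $K_j$ (square matrices acting on that party's space, $\mathbb{C}^2$ for $A,B,C$ and $\mathbb{C}^n$ for $S$) with $\sum_j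 K_j^\dagger K_j=I$, and communicates the outcome $j$ to all others; the choice of party and measurement in each step may depend on all previous outcomes. Outcome $j$ transforms a normalized state $|\phi\rangle$ into $K_j|\phi\rangle/\sqrt{p_j}$ with probability $p_j=\|K_j|\phi\rangle\|^2$ (with $K_j$ acting as the identity on the other parties). The ensemble $\{N_k,|\psi_k\rangle\}$ is indexed by the sequences $k$ of outcomes occurring with positive probability $N_k$. *)

theory Defs
  imports "HOL-Analysis.Analysis"
begin

text \<open>Basis labels are elements of finite types: the two-element type \<open>2 = {0, 1}\<close> for a qubit and
  an arbitrary finite type \<open>'n\<close>, of cardinality \<open>n\<close>, for the party S. The norm on
  \<open>complex ^ 'i\<close> is the Hilbert space norm.\<close>

type_synonym qubits3 = "complex ^ (2 \<times> 2 \<times> 2)"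
type_synonym density3 = "complex ^ (2 \<times> 2 \<times> 2) ^ (2 \<times> 2 \<times> 2)"
type_synonym 'n state4 = "complex ^ (2 \<times> 2 \<times> 2 \<times> 'n)"


section \<open>Three-tangle and three-tangle of assistance\<close>

definition tau3_pure :: "qubits3 \<Rightarrow> real" where
  "tau3_pure \<psi> =
    (let a = (\<lambda>i j k. \<psi> $ (i, j, k));
         d1 = (a 0 0 0)\<^sup>2 * (a 1 1 1)\<^sup>2 + (a 0 0 1)\<^sup>2 * (a 1 1 0)\<^sup>2
            + (a 0 1 0)\<^sup>2 * (a 1 0 1)\<^sup>2 + (a 1 0 0)\<^sup>2 * (a 0 1 1)\<^sup>2;
         d2 = a 0 0 0 * a 1 1 1 * a 0 1 1 * a 1 0 0
            + a 0 0 0 * a 1 1 1 * a 1 0 1 * a 0 1 0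
            + a 0 0 0 * a 1 1 1 * a 1 1 0 * a 0 0 1
            + a 0 1 1 * a 1 0 0 * a 1 0 1 * a 0 1 0
            + a 0 1 1 * a 1 0 0 * a 1 1 0 * a 0 0 1
            + a 1 0 1 * a 0 1 0 * a 1 1 0 * a 0 0 1;
         d3 = a 0 0 0 * a 1 1 0 * a 1 0 1 * a 0 1 1
            + a 1 1 1 * a 0 0 1 * a 0 1 0 * a 1 0 0;
         \<mu>3 = 4 * cmod (d1 - 2 * d2 + 4 * d3)
     in sqrt \<mu>3)"

definition ket_bra :: "complex ^ 'i \<Rightarrow> complex ^ 'i ^ 'i" where
  "ket_bra \<psi> = (\<chi> x y. \<psi> $ x * cnj (\<psi> $ y))"

definition is_decomposition :: "density3 \<Rightarrow> nat \<Rightarrow> (nat \<Rightarrow> real) \<Rightarrow> (nat \<Rightarrow> qubits3) \<Rightarrow> bool" where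
  "is_decomposition \<rho> m p \<phi> \<longleftrightarrow>
     (\<forall>i\<in>{1..m}. p i \<ge> 0 \<and> norm (\<phi> i) = 1) \<and> (\<Sum>i=1..m. p i) = 1 \<and>
     \<rho> = (\<Sum>i=1..m. p i *\<^sub>R ket_bra (\<phi> i))"

definition average_tangles :: "density3 \<Rightarrow> real set" where
  "average_tangles \<rho> = {\<Sum>i=1..m. p i * tau3_pure (\<phi> i) | m p \<phi>. is_decomposition \<rho> m p \<phi>}"

text \<open>The infimum and the supremum are attained as soon as \<open>\<rho>\<close> has a decomposition, in
  particular for the reduced states below; see \<open>tau3_is_minimum\<close>, \<open>tau_a_is_maximum\<close> and
  \<open>average_tangles_rho_ABC_nonempty\<close>.\<close>

definition tau3 :: "density3 \<Rightarrow> real" where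
  "tau3 \<rho> = Inf (average_tangles \<rho>)"

definition tau_a :: "density3 \<Rightarrow> real" where
  "tau_a \<rho> = Sup (average_tangles \<rho>)"


section \<open>The four-tangle\<close>

definition trace_S :: "complex ^ (2 \<times> 2 \<times> 2 \<times> 'n::finite) ^ (2 \<times> 2 \<times> 2 \<times> 'n) \<Rightarrow> density3" where
  "trace_S R = (\<chi> x y. case (x, y) of ((a, b, c), (a', b', c')) \<Rightarrow>
                  (\<Sum>s\<in>UNIV. R $ (a, b, c, s) $ (a', b', c', s)))"

definition rho_ABC :: "'n::finite state4 \<Rightarrow> density3" where
  "rho_ABC \<psi> = trace_S (ket_bra \<psi>)"

definition tau4 :: "'n::finite state4 \<Rightarrow> real" where
  "tau4 \<psi> = sqrt ((tau_a (rho_ABC \<psi>))\<^sup>2 - (tau3 (rho_ABC \<psi>))\<^sup>2)"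


section \<open>Stochastic local operations and classical communication\<close>

definition dagger :: "complex ^ 'i ^ 'i \<Rightarrow> complex ^ 'i ^ 'i" where
  "dagger K = (\<chi> x y. cnj (K $ y $ x))"

definition act_A :: "complex ^ 2 ^ 2 \<Rightarrow> 'n::finite state4 \<Rightarrow> 'n state4" where
  "act_A K \<psi> = (\<chi> x. case x of (a, b, c, s) \<Rightarrow> \<Sum>a'\<in>UNIV. K $ a $ a' * \<psi> $ (a', b, c, s))"

definition act_B :: "complex ^ 2 ^ 2 \<Rightarrow> 'n::finite state4 \<Rightarrow> 'n state4" where
  "act_B K \<psi> = (\<chi> x. case x of (a, b, c, s) \<Rightarrow> \<Sum>b'\<in>UNIV. K $ b $ b' * \<psi> $ (a, b', c, s))"

definition act_C :: "complex ^ 2 ^ 2 \<Rightarrow> 'n::finite state4 \<Rightarrow> 'n state4" where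
  "act_C K \<psi> = (\<chi> x. case x of (a, b, c, s) \<Rightarrow> \<Sum>c'\<in>UNIV. K $ c $ c' * \<psi> $ (a, b, c', s))"

definition act_S :: "complex ^ 'n ^ 'n \<Rightarrow> 'n::finite state4 \<Rightarrow> 'n state4" where
  "act_S K \<psi> = (\<chi> x. case x of (a, b, c, s) \<Rightarrow> \<Sum>s'\<in>UNIV. K $ s $ s' * \<psi> $ (a, b, c, s'))"

text \<open>A local measurement is given by the list of its Kraus operators; outcomes are positions in
  the list.\<close>

datatype (dead 'n::finite) local_measurement =
    Measure_A "(complex ^ 2 ^ 2) list"
  | Measure_B "(complex ^ 2 ^ 2) list"
  | Measure_C "(complex ^ 2 ^ 2) list"
  | Measure_S "(complex ^ 'n ^ 'n) list"

definition kraus_complete :: "(complex ^ 'i ^ 'i) list \<Rightarrow> bool" where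
  "kraus_complete Ks \<longleftrightarrow> (\<Sum>K\<leftarrow>Ks. dagger K ** K) = mat 1"

fun valid_measurement :: "'n::finite local_measurement \<Rightarrow> bool" where
  "valid_measurement (Measure_A Ks) = kraus_complete Ks"
| "valid_measurement (Measure_B Ks) = kraus_complete Ks"
| "valid_measurement (Measure_C Ks) = kraus_complete Ks"
| "valid_measurement (Measure_S Ks) = kraus_complete Ks"

fun kraus_maps :: "'n::finite local_measurement \<Rightarrow> ('n state4 \<Rightarrow> 'n state4) list" where
  "kraus_maps (Measure_A Ks) = map act_A Ks"
| "kraus_maps (Measure_B Ks) = map act_B Ks"
| "kraus_maps (Measure_C Ks) = map act_C Ks"
| "kraus_maps (Measure_S Ks) = map act_S Ks"

text \<open>In \<open>Step M P\<close> the measurement \<open>M\<close> is performed and, after outcome \<open>j\<close>, the parties continue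
  with \<open>P j\<close>; hence every later choice may depend on all previous outcomes. The continuations
  \<open>P j\<close> for \<open>j\<close> beyond the number of outcomes of \<open>M\<close> are irrelevant.\<close>

datatype (dead 'n::finite) protocol =
    Finish
  | Step "'n local_measurement" "nat \<Rightarrow> 'n protocol"

primrec valid_protocol :: "'n::finite protocol \<Rightarrow> bool" where
  "valid_protocol Finish \<longleftrightarrow> True"
| "valid_protocol (Step M P) \<longleftrightarrow>
     valid_measurement M \<and> (\<forall>j<length (kraus_maps M). valid_protocol (P j))"

text \<open>The final ensemble, with one entry (probability, normalized state) for every sequence of
  outcomes that occurs with positive probability.\<close>

primrec ensemble :: "'n::finite protocol \<Rightarrow> 'n state4 \<Rightarrow> (real \<times> 'n state4) list" where
  "ensemble Finish \<psi> = [(1, \<psi>)]"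
| "ensemble (Step M P) \<psi> =
     concat (map (\<lambda>j. let \<phi> = (kraus_maps M ! j) \<psi>; p = (norm \<phi>)\<^sup>2 in
                        if p = 0 then []
                        else map (\<lambda>(N, \<psi>'). (p * N, \<psi>')) (ensemble (P j) ((1 / sqrt p) *\<^sub>R \<phi>)))
                 [0..<length (kraus_maps M)])"


section \<open>Separability\<close>

text \<open>The seven disjuncts are the bipartitions A|BCS, B|ACS, C|ABS, S|ABC, AB|CS, AC|BS, AS|BC.\<close>

definition separable :: "'n::finite state4 \<Rightarrow> bool" where
  "separable \<psi> \<longleftrightarrow>
     (\<exists>(f :: complex ^ 2) (g :: complex ^ (2 \<times> 2 \<times> 'n)).
        \<forall>a b c s. \<psi> $ (a, b, c, s) = f $ a * g $ (b, c, s)) \<or>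
     (\<exists>(f :: complex ^ 2) (g :: complex ^ (2 \<times> 2 \<times> 'n)).
        \<forall>a b c s. \<psi> $ (a, b, c, s) = f $ b * g $ (a, c, s)) \<or>
     (\<exists>(f :: complex ^ 2) (g :: complex ^ (2 \<times> 2 \<times> 'n)).
        \<forall>a b c s. \<psi> $ (a, b, c, s) = f $ c * g $ (a, b, s)) \<or>
     (\<exists>(f :: complex ^ 'n) (g :: complex ^ (2 \<times> 2 \<times> 2)).
        \<forall>a b c s. \<psi> $ (a, b, c, s) = f $ s * g $ (a, b, c)) \<or>
     (\<exists>(f :: complex ^ (2 \<times> 2)) (g :: complex ^ (2 \<times> 'n)).
        \<forall>a b c s. \<psi> $ (a, b, c, s) = f $ (a, b) * g $ (c, s)) \<or>
     (\<exists>(f :: complex ^ (2 \<times> 2)) (g :: complex ^ (2 \<times> 'n)).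
        \<forall>a b c s. \<psi> $ (a, b, c, s) = f $ (a, c) * g $ (b, s)) \<or>
     (\<exists>(f :: complex ^ (2 \<times> 'n)) (g :: complex ^ (2 \<times> 2)).
        \<forall>a b c s. \<psi> $ (a, b, c, s) = f $ (a, s) * g $ (b, c))"


section \<open>Attainment of the minimum and of the maximum\<close>

lemma continuous_on_tau3_pure: "continuous_on S tau3_pure"
  unfolding tau3_pure_def Let_def by (intro continuous_intros)

lemma continuous_on_ket_bra: "continuous_on S ket_bra"
  unfolding ket_bra_def by (intro continuous_intros)

lemma compact_average_tangles: "compact (average_tangles \<rho>)"
proof -
  define K where "K = (\<lambda>\<phi>. (ket_bra \<phi>, tau3_pure \<phi>)) ` sphere (0 :: qubits3) 1"
  have "compact K"
    unfolding K_def
    by (intro compact_continuous_image continuous_on_Pair continuous_on_ket_bra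
        continuous_on_tau3_pure compact_sphere)
  then have hull: "compact (convex hull K)"
    by (rule compact_convex_hull)
  have "average_tangles \<rho> = snd ` (convex hull K \<inter> ({\<rho>} \<times> UNIV))" (is "?L = ?R")
  proof (intro set_eqI iffI)
    fix t assume "t \<in> ?L"
    then obtain m p \<phi> where t: "t = (\<Sum>i=1..m. p i * tau3_pure (\<phi> i))"
      and d: "is_decomposition \<rho> m p \<phi>"
      unfolding average_tangles_def by blast
    have "(\<Sum>i=1..m. p i *\<^sub>R (ket_bra (\<phi> i), tau3_pure (\<phi> i))) = (\<rho>, t)"
      using d t by (simp add: prod_eq_iff fst_sum snd_sum is_decomposition_def)
    moreover have "\<forall>i\<in>{1..m}. 0 \<le> p i \<and> (ket_bra (\<phi> i), tau3_pure (\<phi> i)) \<in> K"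
      using d unfolding K_def is_decomposition_def by auto
    moreover have "sum p {1..m} = 1"
      using d unfolding is_decomposition_def by auto
    ultimately have "(\<rho>, t) \<in> convex hull K"
      unfolding convex_hull_indexed
      by (intro CollectI exI[of _ m] exI[of _ p]
          exI[of _ "\<lambda>i. (ket_bra (\<phi> i), tau3_pure (\<phi> i))"]) auto
    then show "t \<in> ?R"
      by force
  next
    fix t assume "t \<in> ?R"
    then have "(\<rho>, t) \<in> convex hull K" by auto
    then obtain m :: nat and p x where
      x: "\<forall>i\<in>{1..m}. 0 \<le> p i \<and> x i \<in> K" "sum p {1..m} = 1" "(\<Sum>i=1..m. p i *\<^sub>R x i) = (\<rho>, t)"
      unfolding convex_hull_indexed by auto
    have "\<forall>i\<in>{1..m}. \<exists>\<phi>. norm \<phi> = 1 \<and> x i = (ket_bra \<phi>, tau3_pure \<phi>)"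
      using x(1) unfolding K_def by (fastforce simp: dist_norm)
    then obtain \<phi> where
      \<phi>: "\<And>i. i \<in> {1..m} \<Longrightarrow> norm (\<phi> i) = 1 \<and> x i = (ket_bra (\<phi> i), tau3_pure (\<phi> i))"
      by metis
    have "(\<Sum>i=1..m. p i *\<^sub>R x i) = (\<Sum>i=1..m. p i *\<^sub>R (ket_bra (\<phi> i), tau3_pure (\<phi> i)))"
      using \<phi> by (intro sum.cong) auto
    then have "\<rho> = (\<Sum>i=1..m. p i *\<^sub>R ket_bra (\<phi> i))" "t = (\<Sum>i=1..m. p i * tau3_pure (\<phi> i))"
      using x(3) by (auto simp: prod_eq_iff fst_sum snd_sum)
    then show "t \<in> ?L"
      using x(1,2) \<phi> unfolding average_tangles_def is_decomposition_def by blast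
  qed
  moreover have "compact (convex hull K \<inter> ({\<rho>} \<times> UNIV))"
    by (intro compact_Int_closed hull closed_Times) auto
  ultimately show ?thesis
    by (auto intro!: compact_continuous_image continuous_intros)
qed

lemma average_tangles_rho_ABC_nonempty:
  fixes \<psi> :: "'n::finite state4"
  assumes "norm \<psi> = 1"
  shows "average_tangles (rho_ABC \<psi>) \<noteq> {}"
proof -
  define v :: "'n \<Rightarrow> qubits3" where
    "v s = (\<chi> x. case x of (a, b, c) \<Rightarrow> \<psi> $ (a, b, c, s))" for s
  define \<phi> where "\<phi> s = (if v s = 0 then axis (0, 0, 0) 1 else (1 / norm (v s)) *\<^sub>R v s)" for s
  define p where "p s = (norm (v s))\<^sup>2" for s
  have kb: "p s *\<^sub>R ket_bra (\<phi> s) = ket_bra (v s)" for s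
  proof (cases "v s = 0")
    case True
    then show ?thesis by (simp add: vec_eq_iff ket_bra_def p_def)
  next
    case False
    have "ket_bra (r *\<^sub>R w) = r\<^sup>2 *\<^sub>R ket_bra w" for r and w :: qubits3
      by (simp add: vec_eq_iff ket_bra_def power2_eq_square)
    with False show ?thesis by (simp add: p_def \<phi>_def power_divide)
  qed
  have norm_sq: "(norm w)\<^sup>2 = (\<Sum>x\<in>UNIV. (cmod (w $ x))\<^sup>2)" for w :: "complex ^ 'i"
    by (simp add: norm_vec_def L2_set_def sum_nonneg)
  have p_sum: "(\<Sum>s\<in>UNIV. p s) = 1"
  proof -
    have "(\<Sum>s\<in>UNIV. p s) = (\<Sum>s\<in>UNIV. \<Sum>a\<in>UNIV. \<Sum>b\<in>UNIV. \<Sum>c\<in>UNIV. (cmod (\<psi> $ (a, b, c, s)))\<^sup>2)"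
      unfolding p_def norm_sq v_def by (simp add: UNIV_Times_UNIV[symmetric] sum.cartesian_product'
          del: UNIV_Times_UNIV)
    also have "\<dots> = (\<Sum>a\<in>UNIV. \<Sum>b\<in>UNIV. \<Sum>c\<in>UNIV. \<Sum>s\<in>UNIV. (cmod (\<psi> $ (a, b, c, s)))\<^sup>2)"
      by (subst sum.swap, intro sum.cong refl, subst sum.swap, intro sum.cong refl, rule sum.swap)
    also have "\<dots> = (norm \<psi>)\<^sup>2"
      unfolding norm_sq by (simp add: UNIV_Times_UNIV[symmetric] sum.cartesian_product'
          del: UNIV_Times_UNIV)
    finally show ?thesis using assms by simp
  qed
  have rho: "rho_ABC \<psi> = (\<Sum>s\<in>UNIV. p s *\<^sub>R ket_bra (\<phi> s))"
    unfolding kb by (auto simp: vec_eq_iff rho_ABC_def trace_S_def ket_bra_def v_def)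
  obtain h where h: "bij_betw h {1..CARD('n)} (UNIV :: 'n set)"
    using ex_bij_betw_nat_finite_1[of "UNIV :: 'n set"] by auto
  have "is_decomposition (rho_ABC \<psi>) CARD('n) (p \<circ> h) (\<phi> \<circ> h)"
    unfolding is_decomposition_def rho
    using p_sum sum.reindex_bij_betw[OF h, of p]
      sum.reindex_bij_betw[OF h, of "\<lambda>s. p s *\<^sub>R ket_bra (\<phi> s)"]
    by (auto simp: p_def \<phi>_def)
  then show ?thesis
    unfolding average_tangles_def by blast
qed

lemma tau3_is_minimum:
  assumes "average_tangles \<rho> \<noteq> {}"
  shows "tau3 \<rho> \<in> average_tangles \<rho>" "\<And>t. t \<in> average_tangles \<rho> \<Longrightarrow> tau3 \<rho> \<le> t"
  unfolding tau3_def using assms compact_average_tangles[of \<rho>]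
  by (auto intro!: closed_contains_Inf cInf_lower bounded_imp_bdd_below compact_imp_bounded
      compact_imp_closed)

lemma tau_a_is_maximum:
  assumes "average_tangles \<rho> \<noteq> {}"
  shows "tau_a \<rho> \<in> average_tangles \<rho>" "\<And>t. t \<in> average_tangles \<rho> \<Longrightarrow> t \<le> tau_a \<rho>"
  unfolding tau_a_def using assms compact_average_tangles[of \<rho>]
  by (auto intro!: closed_contains_Sup cSup_upper bounded_imp_bdd_above compact_imp_bounded
      compact_imp_closed)

end

theory Submission
  imports Defs
begin

text \<open>An operator \<open>K\<close> on one qubit multiplies the hyperdeterminant by \<open>(det K)\<^sup>2\<close>, hence \<open>\<tau>\<^sub>3\<close> by
  \<open>|det K|\<close>. If \<open>K\<close> is invertible, the decompositions of the reduced states before and after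
  correspond to each other, so the outcome contributes \<open>|det K| \<tau>\<^sub>4(\<psi>)\<close> to the average; if \<open>K\<close> is
  singular, the outcome is a product state and contributes nothing. Since
  \<open>2 |det K| \<le> Tr (K\<^sup>\<dagger> K)\<close>, the factors sum to at most 1. A measurement of S decomposes
  \<open>\<rho>\<^sub>A\<^sub>B\<^sub>C\<close> into the reduced states of the outcomes; \<open>\<tau>\<^sub>a\<close> is concave and \<open>\<tau>\<^sub>3\<close> convex under such
  decompositions, and \<open>sqrt (x\<^sup>2 - y\<^sup>2)\<close> is superadditive on \<open>0 \<le> y \<le> x\<close>. For a separable state all
  vectors in all decompositions of \<open>\<rho>\<^sub>A\<^sub>B\<^sub>C\<close> are products, so that \<open>\<tau>\<^sub>a = \<tau>\<^sub>3 = 0\<close>, or, for the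
  bipartition S|ABC, are all proportional, so that \<open>\<tau>\<^sub>a = \<tau>\<^sub>3\<close>.\<close>

section \<open>The hyperdeterminant\<close>

text \<open>Cayley's hyperdeterminant of a 2x2x2 array, equal to the polynomial d1 - 2 d2 + 4 d3 of
  the three-tangle. This form singles out the first index; the symmetry under exchange of indices is
  recovered below.\<close>

definition hdet :: "(2 \<Rightarrow> 2 \<Rightarrow> 2 \<Rightarrow> complex) \<Rightarrow> complex" where
  "hdet a = (a 0 0 0 * a 1 1 1 + a 0 1 1 * a 1 0 0 - a 0 0 1 * a 1 1 0 - a 0 1 0 * a 1 0 1)\<^sup>2
     - 4 * (a 0 0 0 * a 0 1 1 - a 0 0 1 * a 0 1 0) * (a 1 0 0 * a 1 1 1 - a 1 0 1 * a 1 1 0)"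

lemma tau3_pure_hdet: "tau3_pure v = 2 * sqrt (cmod (hdet (\<lambda>i j k. v $ (i, j, k))))"
proof -
  have "tau3_pure v = sqrt (4 * cmod (hdet (\<lambda>i j k. v $ (i, j, k))))"
    unfolding tau3_pure_def Let_def hdet_def
    by (intro arg_cong[where f = "\<lambda>z. sqrt (4 * cmod z)"]) algebra
  then show ?thesis by (simp add: real_sqrt_mult)
qed

lemma hdet_swap12: "hdet (\<lambda>i j k. a j i k) = hdet a"
  unfolding hdet_def by algebra

lemma hdet_swap13: "hdet (\<lambda>i j k. a k j i) = hdet a"
  unfolding hdet_def by algebra

text \<open>The hyperdeterminant is the discriminant of the binary quadratic form
  \<open>det (x a\<^sub>0 + y a\<^sub>1)\<close>, on which a substitution in \<open>(x, y)\<close> acts by the squared determinant.\<close>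

lemma hdet_transform:
  "hdet (\<lambda>i j k. K i 0 * a 0 j k + K i 1 * a 1 j k) = (K 0 0 * K 1 1 - K 0 1 * K 1 0)\<^sup>2 * hdet a"
proof -
  define D0 where "D0 = a 0 0 0 * a 0 1 1 - a 0 0 1 * a 0 1 0"
  define D1 where
    "D1 = a 0 0 0 * a 1 1 1 + a 0 1 1 * a 1 0 0 - a 0 0 1 * a 1 1 0 - a 0 1 0 * a 1 0 1"
  define D2 where "D2 = a 1 0 0 * a 1 1 1 - a 1 0 1 * a 1 1 0"
  let ?b = "\<lambda>i j k. K i 0 * a 0 j k + K i 1 * a 1 j k"
  have q: "?b i 0 0 * ?b i 1 1 - ?b i 0 1 * ?b i 1 0
      = D0 * (K i 0)\<^sup>2 + D1 * K i 0 * K i 1 + D2 * (K i 1)\<^sup>2" for i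
    unfolding D0_def D1_def D2_def by algebra
  have m: "?b 0 0 0 * ?b 1 1 1 + ?b 0 1 1 * ?b 1 0 0 - ?b 0 0 1 * ?b 1 1 0 - ?b 0 1 0 * ?b 1 0 1
      = 2 * D0 * K 0 0 * K 1 0 + D1 * (K 0 0 * K 1 1 + K 0 1 * K 1 0) + 2 * D2 * K 0 1 * K 1 1"
    unfolding D0_def D1_def D2_def by algebra
  have "hdet a = D1\<^sup>2 - 4 * D0 * D2"
    unfolding hdet_def D0_def D1_def D2_def by simp
  moreover have "hdet ?b = (2 * D0 * K 0 0 * K 1 0 + D1 * (K 0 0 * K 1 1 + K 0 1 * K 1 0)
        + 2 * D2 * K 0 1 * K 1 1)\<^sup>2
      - 4 * (D0 * (K 0 0)\<^sup>2 + D1 * K 0 0 * K 0 1 + D2 * (K 0 1)\<^sup>2)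
          * (D0 * (K 1 0)\<^sup>2 + D1 * K 1 0 * K 1 1 + D2 * (K 1 1)\<^sup>2)"
    unfolding hdet_def q m ..
  ultimately show ?thesis by algebra
qed

text \<open>Here the quadratic form is (x f(0) + y f(1))^2 det g, a perfect square, so its
  discriminant vanishes.\<close>

lemma hdet_product: "hdet (\<lambda>i j k. f i * g j k) = 0"
  unfolding hdet_def by algebra

section \<open>Homogeneity of the three-tangle\<close>

lemma tau3_pure_nonneg: "0 \<le> tau3_pure v"
  by (simp add: tau3_pure_hdet)

lemma tau3_pure_cong:
  assumes "hdet (\<lambda>i j k. v $ (i, j, k)) = z * hdet (\<lambda>i j k. w $ (i, j, k))"
  shows "tau3_pure v = sqrt (cmod z) * tau3_pure w"
  using assms by (simp add: tau3_pure_hdet norm_mult real_sqrt_mult)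

lemma tau3_pure_scale: "tau3_pure (c *s v) = (cmod c)\<^sup>2 * tau3_pure v"
proof -
  have "hdet (\<lambda>i j k. (c *s v) $ (i, j, k)) = c ^ 4 * hdet (\<lambda>i j k. v $ (i, j, k))"
    unfolding hdet_def vector_smult_component by algebra
  moreover have "sqrt (cmod (c ^ 4)) = (cmod c)\<^sup>2"
    by (simp add: norm_power real_sqrt_unique)
  ultimately show ?thesis using tau3_pure_cong by metis
qed

lemma scaleR_vec_complex: "r *\<^sub>R v = complex_of_real r *s (v :: complex ^ 'i)"
  unfolding vec_eq_iff vector_scaleR_component vector_smult_component
  by (simp add: scaleR_conv_of_real)

lemma tau3_pure_scaleR: "tau3_pure (r *\<^sub>R v) = r\<^sup>2 * tau3_pure v"
  by (simp add: scaleR_vec_complex tau3_pure_scale)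

lemma UNIV_2_zero_one: "(UNIV :: 2 set) = {0, 1}"
  by (rule card_seteq[symmetric]) auto

lemma cases_zero_one: "i = 0 \<or> i = 1" for i :: 2
  using UNIV_2_zero_one by auto

lemma sum_UNIV_2: "(\<Sum>i\<in>UNIV. f (i :: 2)) = f 0 + f 1"
  by (simp add: UNIV_2_zero_one)


section \<open>Unnormalized decompositions\<close>

text \<open>Both \<open>ket_bra\<close> and \<open>tau3_pure\<close> scale with the squared modulus
  of a factor, so a weight p can be absorbed as sqrt p into the vector. Without weights and trace
  condition, decompositions can be concatenated and mapped freely.\<close>

definition tangle_sums :: "density3 \<Rightarrow> real set" where
  "tangle_sums \<rho> = {\<Sum>v\<leftarrow>vs. tau3_pure v | vs. \<rho> = (\<Sum>v\<leftarrow>vs. ket_bra v)}"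

lemma tangle_sumsI: "\<rho> = (\<Sum>v\<leftarrow>vs. ket_bra v) \<Longrightarrow> t = (\<Sum>v\<leftarrow>vs. tau3_pure v) \<Longrightarrow> t \<in> tangle_sums \<rho>"
  unfolding tangle_sums_def by blast

lemma tangle_sums_zero: "0 \<in> tangle_sums 0"
  by (rule tangle_sumsI[of _ "[]"]) auto

lemma tangle_sums_add:
  assumes "t \<in> tangle_sums \<rho>" "t' \<in> tangle_sums \<rho>'"
  shows "t + t' \<in> tangle_sums (\<rho> + \<rho>')"
proof -
  obtain vs vs' where "t = (\<Sum>v\<leftarrow>vs. tau3_pure v)" "\<rho> = (\<Sum>v\<leftarrow>vs. ket_bra v)"
    "t' = (\<Sum>v\<leftarrow>vs'. tau3_pure v)" "\<rho>' = (\<Sum>v\<leftarrow>vs'. ket_bra v)"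
    using assms unfolding tangle_sums_def by blast
  then show ?thesis by (intro tangle_sumsI[of _ "vs @ vs'"]) auto
qed

lemma tangle_sums_sum_list:
  assumes "\<And>x. x \<in> set xs \<Longrightarrow> t x \<in> tangle_sums (\<rho> x)"
  shows "(\<Sum>x\<leftarrow>xs. t x) \<in> tangle_sums (\<Sum>x\<leftarrow>xs. \<rho> x)"
  using assms by (induction xs) (auto intro: tangle_sums_zero tangle_sums_add)

lemma ket_bra_scaleR: "ket_bra (r *\<^sub>R v) = r\<^sup>2 *\<^sub>R ket_bra v"
  by (simp add: vec_eq_iff ket_bra_def power2_eq_square)

lemma norm_sq_vec: "(norm v)\<^sup>2 = (\<Sum>x\<in>UNIV. (cmod (v $ x))\<^sup>2)" for v :: "complex ^ 'i"
  by (simp add: norm_vec_def L2_set_def sum_nonneg)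

lemma trace_ket_bra: "trace (ket_bra v) = complex_of_real ((norm v)\<^sup>2)"
  by (simp add: trace_def ket_bra_def norm_sq_vec complex_norm_square del: of_real_power)

lemma trace_sum_list_ket_bra:
  "trace (\<Sum>v\<leftarrow>vs. ket_bra v) = complex_of_real (\<Sum>v\<leftarrow>vs. (norm v)\<^sup>2)"
proof (induction vs)
  case Nil
  then show ?case by (simp add: trace_def)
next
  case (Cons v vs)
  then show ?case by (simp add: trace_add trace_ket_bra)
qed

text \<open>The factor \<open>r\<close> serves the unnormalized outcomes of a measurement, whose
  reduced states have a trace below 1 in general.\<close>

lemma average_tangles_imp_tangle_sums:
  assumes "t \<in> average_tangles \<rho>" "0 \<le> r"
  shows "r * t \<in> tangle_sums (r *\<^sub>R \<rho>)"
proof -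
  obtain m p \<phi> where t: "t = (\<Sum>i=1..m. p i * tau3_pure (\<phi> i))"
    and d: "is_decomposition \<rho> m p \<phi>"
    using assms(1) unfolding average_tangles_def by blast
  define vs where "vs = map (\<lambda>i. sqrt (r * p i) *\<^sub>R \<phi> i) [1..<Suc m]"
  have p: "0 \<le> p i" if "i \<in> {1..m}" for i
    using d that unfolding is_decomposition_def by auto
  have sl: "(\<Sum>i\<leftarrow>[1..<Suc m]. f i) = (\<Sum>i=1..m. f i)" for f :: "nat \<Rightarrow> 'b::comm_monoid_add"
    by (simp only: interv_sum_list_conv_sum_set_nat set_upt atLeastLessThanSuc_atLeastAtMost)
  have "(\<Sum>v\<leftarrow>vs. ket_bra v) = (\<Sum>i=1..m. (r * p i) *\<^sub>R ket_bra (\<phi> i))"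
    unfolding vs_def map_map sl o_def ket_bra_scaleR
    using p assms(2) by (intro sum.cong) auto
  also have "\<dots> = r *\<^sub>R \<rho>"
    using d unfolding is_decomposition_def by (simp add: scaleR_sum_right)
  finally have 1: "r *\<^sub>R \<rho> = (\<Sum>v\<leftarrow>vs. ket_bra v)" ..
  have "(\<Sum>v\<leftarrow>vs. tau3_pure v) = (\<Sum>i=1..m. (r * p i) * tau3_pure (\<phi> i))"
    unfolding vs_def map_map sl o_def tau3_pure_scaleR
    using p assms(2) by (intro sum.cong) auto
  also have "\<dots> = r * t"
    unfolding t by (simp add: sum_distrib_left mult.assoc)
  finally show ?thesis using 1 by (intro tangle_sumsI[of _ vs]) auto
qed

lemma tangle_sums_imp_average_tangles:
  assumes "t \<in> tangle_sums \<rho>" "trace \<rho> = 1"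
  shows "t \<in> average_tangles \<rho>"
proof -
  obtain vs where t: "t = (\<Sum>v\<leftarrow>vs. tau3_pure v)" and \<rho>: "\<rho> = (\<Sum>v\<leftarrow>vs. ket_bra v)"
    using assms(1) unfolding tangle_sums_def by blast
  \<comment> \<open>\<open>is_decomposition\<close> counts from 1, list positions from 0.\<close>
  define v where "v i = vs ! (i - 1)" for i
  \<comment> \<open>A zero vector has no direction; any unit vector can stand in, as its weight is
    0.\<close>
  define \<phi> where "\<phi> i = (if v i = 0 then axis (0, 0, 0) 1 else (1 / norm (v i)) *\<^sub>R v i)" for i
  define p where "p i = (norm (v i))\<^sup>2" for i
  have v: "v i = norm (v i) *\<^sub>R \<phi> i" for i
    by (simp add: \<phi>_def)
  have sl: "(\<Sum>x\<leftarrow>vs. f x) = (\<Sum>i=1..length vs. f (v i))" for f :: "qubits3 \<Rightarrow> 'b::comm_monoid_add"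
    unfolding v_def
    by (subst sum_list_sum_nth) (simp add: sum.shift_bounds_Suc_ivl[symmetric] sum.shift_bounds_cl_Suc_ivl
        atLeast0LessThan sum.atLeast1_atMost_eq)
  have "complex_of_real (\<Sum>v\<leftarrow>vs. (norm v)\<^sup>2) = 1"
    using assms(2) unfolding \<rho> trace_sum_list_ket_bra .
  then have "(\<Sum>v\<leftarrow>vs. (norm v)\<^sup>2) = 1"
    by (simp only: of_real_eq_1_iff)
  then have 1: "(\<Sum>i=1..length vs. p i) = 1"
    unfolding sl p_def .
  have "ket_bra (v i) = p i *\<^sub>R ket_bra (\<phi> i)" "tau3_pure (v i) = p i * tau3_pure (\<phi> i)" for i
    unfolding p_def by (subst v, simp only: ket_bra_scaleR tau3_pure_scaleR)+
  then have "\<rho> = (\<Sum>i=1..length vs. p i *\<^sub>R ket_bra (\<phi> i))"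
    "t = (\<Sum>i=1..length vs. p i * tau3_pure (\<phi> i))"
    using t \<rho> unfolding sl by auto
  then show ?thesis
    using 1 unfolding average_tangles_def is_decomposition_def
    by (intro CollectI exI[of _ "length vs"] exI[of _ p] exI[of _ \<phi>]) (auto simp: p_def \<phi>_def)
qed

lemma average_tangles_nonneg:
  assumes "t \<in> average_tangles \<rho>" shows "0 \<le> t"
  using assms unfolding average_tangles_def is_decomposition_def
  by (auto intro!: sum_nonneg mult_nonneg_nonneg tau3_pure_nonneg)


section \<open>Reduced states\<close>

text \<open>The unnormalized vector of ABC next to the basis state s of S; the slices form one
  decomposition of the reduced state.\<close>

definition slice :: "'n::finite state4 \<Rightarrow> 'n \<Rightarrow> qubits3" where
  "slice \<psi> s = (\<chi> x. case x of (a, b, c) \<Rightarrow> \<psi> $ (a, b, c, s))"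

lemma slice_nth [simp]: "slice \<psi> s $ (a, b, c) = \<psi> $ (a, b, c, s)"
  by (simp add: slice_def)

lemma slice_scaleR: "slice (r *\<^sub>R \<psi>) s = r *\<^sub>R slice \<psi> s"
  by (auto simp: vec_eq_iff)

lemma rho_ABC_slice: "rho_ABC \<psi> = (\<Sum>s\<in>UNIV. ket_bra (slice \<psi> s))"
  by (auto simp: vec_eq_iff rho_ABC_def trace_S_def ket_bra_def)

lemma additive_rho_ABC:
  fixes C :: "density3 \<Rightarrow> 'b::ab_group_add"
  assumes C: "\<And>X Y. C (X + Y) = C X + C Y"
  shows "C (rho_ABC \<psi>) = (\<Sum>s\<in>UNIV. C (ket_bra (slice \<psi> s)))"
proof -
  interpret additive C by unfold_locales (rule C)
  show ?thesis unfolding rho_ABC_slice by (rule sum)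
qed

lemma norm_sq_slice: "(norm \<psi>)\<^sup>2 = (\<Sum>s\<in>UNIV. (norm (slice \<psi> s))\<^sup>2)"
proof -
  have "(\<Sum>s\<in>UNIV. (norm (slice \<psi> s))\<^sup>2)
      = (\<Sum>s\<in>UNIV. \<Sum>a\<in>UNIV. \<Sum>b\<in>UNIV. \<Sum>c\<in>UNIV. (cmod (\<psi> $ (a, b, c, s)))\<^sup>2)"
    unfolding norm_sq_vec by (simp add: UNIV_Times_UNIV[symmetric] sum.cartesian_product'
        del: UNIV_Times_UNIV)
  also have "\<dots> = (\<Sum>a\<in>UNIV. \<Sum>b\<in>UNIV. \<Sum>c\<in>UNIV. \<Sum>s\<in>UNIV. (cmod (\<psi> $ (a, b, c, s)))\<^sup>2)"
    by (subst sum.swap, intro sum.cong refl, subst sum.swap, intro sum.cong refl, rule sum.swap)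
  also have "\<dots> = (norm \<psi>)\<^sup>2"
    unfolding norm_sq_vec by (simp add: UNIV_Times_UNIV[symmetric] sum.cartesian_product'
        del: UNIV_Times_UNIV)
  finally show ?thesis ..
qed

lemma trace_sum: "trace (\<Sum>s\<in>S. f s) = (\<Sum>s\<in>S. trace (f s))"
  for f :: "'b \<Rightarrow> complex ^ 'i ^ 'i"
  by (simp add: trace_def sum.swap[of _ _ S])

lemma trace_rho_ABC: "trace (rho_ABC \<psi>) = complex_of_real ((norm \<psi>)\<^sup>2)"
  by (simp add: rho_ABC_slice trace_sum trace_ket_bra norm_sq_slice)

lemma rho_ABC_scaleR: "rho_ABC (r *\<^sub>R \<psi>) = r\<^sup>2 *\<^sub>R rho_ABC \<psi>"
  by (simp add: rho_ABC_slice slice_scaleR ket_bra_scaleR scaleR_sum_right)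

section \<open>Extremal averages over unnormalized decompositions\<close>

lemma average_tangles_rho_ABC:
  assumes "norm \<psi> = 1"
  shows "average_tangles (rho_ABC \<psi>) = tangle_sums (rho_ABC \<psi>)"
  using tangle_sums_imp_average_tangles[of _ "rho_ABC \<psi>"]
    average_tangles_imp_tangle_sums[of _ "rho_ABC \<psi>" 1] assms
  by (auto simp: trace_rho_ABC)

lemma tau_a_mem:
  assumes "norm \<psi> = 1" shows "tau_a (rho_ABC \<psi>) \<in> tangle_sums (rho_ABC \<psi>)"
  using tau_a_is_maximum(1)[OF average_tangles_rho_ABC_nonempty[of \<psi>]] assms
  by (simp add: average_tangles_rho_ABC)

lemma tau_a_ge:
  assumes "norm \<psi> = 1" "t \<in> tangle_sums (rho_ABC \<psi>)" shows "t \<le> tau_a (rho_ABC \<psi>)"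
  using tau_a_is_maximum(2)[OF average_tangles_rho_ABC_nonempty[of \<psi>]] assms
  by (simp add: average_tangles_rho_ABC)

lemma tau3_mem:
  assumes "norm \<psi> = 1" shows "tau3 (rho_ABC \<psi>) \<in> tangle_sums (rho_ABC \<psi>)"
  using tau3_is_minimum(1)[OF average_tangles_rho_ABC_nonempty[of \<psi>]] assms
  by (simp add: average_tangles_rho_ABC)

lemma tau3_le:
  assumes "norm \<psi> = 1" "t \<in> tangle_sums (rho_ABC \<psi>)" shows "tau3 (rho_ABC \<psi>) \<le> t"
  using tau3_is_minimum(2)[OF average_tangles_rho_ABC_nonempty[of \<psi>]] assms
  by (simp add: average_tangles_rho_ABC)

lemma tau3_le_tau_a:
  assumes "norm \<psi> = 1"
  shows "0 \<le> tau3 (rho_ABC \<psi>)" "tau3 (rho_ABC \<psi>) \<le> tau_a (rho_ABC \<psi>)"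
  using assms tau3_mem tau3_le tau_a_mem average_tangles_nonneg average_tangles_rho_ABC by blast+

lemma tau4_nonneg:
  assumes "norm \<psi> = 1" shows "0 \<le> tau4 \<psi>"
  using tau3_le_tau_a[OF assms] by (simp add: tau4_def power_mono)


section \<open>Linear maps on the three qubits\<close>

abbreviation clinear :: "(complex ^ 'i \<Rightarrow> complex ^ 'j) \<Rightarrow> bool" where
  "clinear \<equiv> Vector_Spaces.linear (*s) (*s)"

lemma clinearI:
  assumes "\<And>v w. f (v + w) = f v + f w" "\<And>c v. f (c *s v) = c *s f v"
  shows "clinear f"
  using assms by unfold_locales (auto simp: vec_eq_iff algebra_simps)

lemma ket_bra_matrix: "ket_bra (M *v v) = M ** ket_bra v ** dagger M"
  by (simp add: vec_eq_iff ket_bra_def matrix_vector_mult_def matrix_matrix_mult_def dagger_def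
      sum_distrib_left sum_distrib_right mult_ac)

text \<open>Applying \<open>f\<close> to each vector of a decomposition of the old reduced state
  decomposes the new one, because on matrices \<open>f\<close> acts by a conjugation, which is
  additive.\<close>

lemma tangle_sums_linear:
  assumes f: "clinear f" and d: "\<And>v. tau3_pure (f v) = d * tau3_pure v"
    and sl: "\<And>s. slice \<phi> s = f (slice \<psi> s)"
    and t: "t \<in> tangle_sums (rho_ABC \<psi>)"
  shows "d * t \<in> tangle_sums (rho_ABC \<phi>)"
proof -
  define C where "C X = matrix f ** X ** dagger (matrix f)" for X
  have kb: "ket_bra (f v) = C (ket_bra v)" for v
    unfolding C_def ket_bra_matrix[symmetric] by (simp add: matrix_works[OF f])
  have C_add: "C (X + Y) = C X + C Y" for X Y
    by (simp add: C_def vec_eq_iff matrix_matrix_mult_def sum.distrib algebra_simps)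
  have C_0: "C 0 = 0"
    using C_add[of 0 0] by simp
  obtain vs where vs: "t = (\<Sum>v\<leftarrow>vs. tau3_pure v)" "rho_ABC \<psi> = (\<Sum>v\<leftarrow>vs. ket_bra v)"
    using t unfolding tangle_sums_def by blast
  have "rho_ABC \<phi> = C (rho_ABC \<psi>)"
    unfolding additive_rho_ABC[of C, OF C_add] by (simp add: rho_ABC_slice sl kb)
  also have "\<dots> = (\<Sum>v\<leftarrow>map f vs. ket_bra v)"
    unfolding vs by (induction vs) (auto simp: C_0 C_add kb)
  finally show ?thesis
    by (rule tangle_sumsI) (simp add: vs o_def d sum_list_const_mult)
qed

text \<open>Decompositions are carried over by \<open>f\<close> and back by its inverse
  \<open>g\<close>, so both extremal averages are multiplied by exactly \<open>d\<close>.\<close>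

lemma tau4_linear:
  assumes n: "norm \<psi> = 1" "norm \<phi> = 1"
    and f: "clinear f" "clinear g" "\<And>v. f (g v) = v" "\<And>v. g (f v) = v"
    and d: "0 < d" "\<And>v. tau3_pure (f v) = d * tau3_pure v"
    and sl: "\<And>s. slice \<phi> s = f (slice \<psi> s)"
  shows "tau4 \<phi> = d * tau4 \<psi>"
proof -
  have to: "d * t \<in> tangle_sums (rho_ABC \<phi>)" if "t \<in> tangle_sums (rho_ABC \<psi>)" for t
    by (rule tangle_sums_linear[OF f(1) d(2) sl that])
  have g: "tau3_pure (g v) = 1 / d * tau3_pure v" for v
    using d(2)[of "g v"] d(1) f(3) by simp
  have back_to: "t / d \<in> tangle_sums (rho_ABC \<psi>)" if "t \<in> tangle_sums (rho_ABC \<phi>)" for t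
    using tangle_sums_linear[OF f(2) g _ that, of \<psi>] by (simp add: f(4) sl)
  have "tau_a (rho_ABC \<phi>) = d * tau_a (rho_ABC \<psi>)"
    using tau_a_ge[OF n(2) to[OF tau_a_mem[OF n(1)]]] tau_a_ge[OF n(1) back_to[OF tau_a_mem[OF n(2)]]] d(1)
    by (simp add: divide_le_eq mult.commute)
  moreover have "tau3 (rho_ABC \<phi>) = d * tau3 (rho_ABC \<psi>)"
    using tau3_le[OF n(2) to[OF tau3_mem[OF n(1)]]] tau3_le[OF n(1) back_to[OF tau3_mem[OF n(2)]]] d(1)
    by (simp add: le_divide_eq mult.commute)
  ultimately show ?thesis
    using d(1) by (simp add: tau4_def power_mult_distrib right_diff_distrib[symmetric] real_sqrt_mult)
qed


section \<open>Product states\<close>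

text \<open>A linear functional vanishing on the range of \<open>\<rho>\<close> vanishes on every vector of every
  decomposition of \<open>\<rho>\<close>, since \<open>\<langle>u|\<rho>|u\<rangle>\<close> is a sum of squared moduli.\<close>

lemma decomposition_functional:
  fixes u :: "2 \<times> 2 \<times> 2 \<Rightarrow> complex"
  assumes \<rho>: "rho_ABC \<psi> = (\<Sum>v\<leftarrow>vs. ket_bra v)"
    and u: "\<And>s. (\<Sum>x\<in>UNIV. u x * slice \<psi> s $ x) = 0" and v: "v \<in> set vs"
  shows "(\<Sum>x\<in>UNIV. u x * v $ x) = 0"
proof -
  define L where "L w = (\<Sum>x\<in>UNIV. u x * w $ x)" for w :: qubits3
  define Q where "Q X = (\<Sum>x\<in>UNIV. \<Sum>y\<in>UNIV. u x * X $ x $ y * cnj (u y))" for X :: density3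
  have Q: "Q (ket_bra w) = complex_of_real ((cmod (L w))\<^sup>2)" for w
  proof -
    have "Q (ket_bra w) = (\<Sum>x\<in>UNIV. \<Sum>y\<in>UNIV. (u x * w $ x) * cnj (u y * w $ y))"
      by (simp add: Q_def ket_bra_def mult_ac)
    also have "\<dots> = L w * cnj (L w)"
      by (simp only: L_def cnj_sum sum_product)
    finally show ?thesis by (simp only: complex_norm_square)
  qed
  have Q_add: "Q (X + Y) = Q X + Q Y" for X Y
    by (simp add: Q_def algebra_simps sum.distrib)
  have Q_0: "Q 0 = 0" by (simp add: Q_def)
  have "Q (rho_ABC \<psi>) = (\<Sum>s\<in>UNIV. Q (ket_bra (slice \<psi> s)))"
    by (rule additive_rho_ABC) (rule Q_add)
  also have "\<dots> = 0"
    using u by (simp add: Q L_def)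
  finally have "Q (\<Sum>v\<leftarrow>vs. ket_bra v) = 0"
    by (simp add: \<rho>)
  moreover have "Q (\<Sum>v\<leftarrow>vs. ket_bra v) = complex_of_real (\<Sum>v\<leftarrow>vs. (cmod (L v))\<^sup>2)"
    by (induction vs) (auto simp: Q_0 Q_add Q)
  ultimately have "(\<Sum>v\<leftarrow>vs. (cmod (L v))\<^sup>2) = 0"
    by (simp only: of_real_eq_0_iff)
  then have "(cmod (L v))\<^sup>2 = 0"
    using v by (subst (asm) sum_list_nonneg_eq_0_iff) auto
  then show ?thesis by (simp add: L_def)
qed

text \<open>Two-term linear relations between components that hold for all slices pass to every
  vector of every decomposition. If they force \<tau>_3 to be \<open>c\<close> times the squared
  norm, every average equals \<open>c\<close>, since the squared norms sum to 1; hence maximum and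
  minimum agree.\<close>

lemma tau4_eq_0:
  assumes n: "norm \<psi> = 1"
    and c: "\<And>v. (\<And>x y \<alpha> \<beta>. (\<And>s. \<alpha> * slice \<psi> s $ x = \<beta> * slice \<psi> s $ y) \<Longrightarrow> \<alpha> * v $ x = \<beta> * v $ y)
       \<Longrightarrow> tau3_pure v = c * (norm v)\<^sup>2"
  shows "tau4 \<psi> = 0"
proof -
  have const: "t = c" if "t \<in> tangle_sums (rho_ABC \<psi>)" for t
  proof -
    obtain vs where vs: "t = (\<Sum>v\<leftarrow>vs. tau3_pure v)" "rho_ABC \<psi> = (\<Sum>v\<leftarrow>vs. ket_bra v)"
      using \<open>t \<in> _\<close> unfolding tangle_sums_def by blast
    have "tau3_pure v = c * (norm v)\<^sup>2" if v: "v \<in> set vs" for v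
    proof (rule c)
      fix x y \<alpha> \<beta>
      assume eq: "\<And>s. \<alpha> * slice \<psi> s $ x = \<beta> * slice \<psi> s $ y"
      \<comment> \<open>The functional w -> \<alpha> w_x - \<beta> w_y, as a difference of two terms
        so that x = y is covered too.\<close>
      define u where "u z = (if z = x then \<alpha> else 0) - (if z = y then \<beta> else 0)" for z
      have L: "(\<Sum>z\<in>UNIV. u z * w $ z) = \<alpha> * w $ x - \<beta> * w $ y" for w :: qubits3
        by (simp add: u_def left_diff_distrib sum_subtractf if_distrib[of "\<lambda>q. q * _"] cong: if_cong)
      show "\<alpha> * v $ x = \<beta> * v $ y"
        using decomposition_functional[OF vs(2) _ v, of u] eq by (simp add: L)
    qed
    then have "t = (\<Sum>v\<leftarrow>vs. c * (norm v)\<^sup>2)"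
      unfolding vs by (auto intro!: arg_cong[of _ _ sum_list])
    also have "\<dots> = c * (\<Sum>v\<leftarrow>vs. (norm v)\<^sup>2)"
      by (simp add: sum_list_const_mult)
    also have "complex_of_real (\<Sum>v\<leftarrow>vs. (norm v)\<^sup>2) = 1"
      unfolding trace_sum_list_ket_bra[symmetric] vs(2)[symmetric] trace_rho_ABC n by simp
    then have "(\<Sum>v\<leftarrow>vs. (norm v)\<^sup>2) = 1"
      by (simp only: of_real_eq_1_iff)
    finally show ?thesis by simp
  qed
  then have "tau_a (rho_ABC \<psi>) = c" "tau3 (rho_ABC \<psi>) = c"
    using tau_a_mem[OF n] tau3_mem[OF n] by blast+
  then show ?thesis by (simp add: tau4_def)
qed

lemma tau3_pure_product:
  assumes "\<And>a b c. v $ (a, b, c) = f a * g b c"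
  shows "tau3_pure v = 0"
  by (simp add: tau3_pure_hdet assms hdet_product)

lemma state4_nonzero:
  assumes "norm \<psi> = 1" obtains a b c s where "\<psi> $ (a, b, c, s) \<noteq> 0"
proof -
  have "\<psi> \<noteq> 0" using assms by auto
  then show ?thesis using that by (auto simp: vec_eq_iff)
qed

lemma tau4_product_A:
  assumes n: "norm \<psi> = 1" and p: "\<And>a b c s. \<psi> $ (a, b, c, s) = f a * g b c s"
  shows "tau4 \<psi> = 0"
proof -
  obtain a0 where a0: "f a0 \<noteq> 0"
    using state4_nonzero[OF n] p by (metis mult_zero_left)
  have "tau3_pure v = 0 * (norm v)\<^sup>2"
    if "\<And>x y \<alpha> \<beta>. (\<And>s. \<alpha> * slice \<psi> s $ x = \<beta> * slice \<psi> s $ y) \<Longrightarrow> \<alpha> * v $ x = \<beta> * v $ y" for v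
  proof -
    \<comment> \<open>Cross-multiplying with the nonzero entry \<open>f a0\<close> gives relations
      shared by all slices that separate A from BC in \<open>v\<close>.\<close>
    have "f a0 * v $ (a, b, c) = f a * v $ (a0, b, c)" for a b c
      by (rule that) (simp add: p)
    then have "v $ (a, b, c) = f a * (v $ (a0, b, c) / f a0)" for a b c
      using a0 by (simp add: field_simps)
    then have "tau3_pure v = 0" by (rule tau3_pure_product)
    then show ?thesis by simp
  qed
  then show ?thesis using tau4_eq_0[OF n] by blast
qed

text \<open>The cut AS|BC: each slice is a product of a vector of A with the same \<open>g\<close>,
  so the pivot is now an entry of \<open>g\<close>.\<close>

lemma tau4_product_BC:
  assumes n: "norm \<psi> = 1" and p: "\<And>a b c s. \<psi> $ (a, b, c, s) = f a s * g b c"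
  shows "tau4 \<psi> = 0"
proof -
  obtain b0 c0 where g0: "g b0 c0 \<noteq> 0"
    using state4_nonzero[OF n] p by (metis mult_zero_right)
  have "tau3_pure v = 0 * (norm v)\<^sup>2"
    if "\<And>x y \<alpha> \<beta>. (\<And>s. \<alpha> * slice \<psi> s $ x = \<beta> * slice \<psi> s $ y) \<Longrightarrow> \<alpha> * v $ x = \<beta> * v $ y" for v
  proof -
    have "g b0 c0 * v $ (a, b, c) = g b c * v $ (a, b0, c0)" for a b c
      by (rule that) (simp add: p)
    then have "v $ (a, b, c) = v $ (a, b0, c0) / g b0 c0 * g b c" for a b c
      using g0 by (simp add: field_simps)
    then have "tau3_pure v = 0" by (rule tau3_pure_product)
    then show ?thesis by simp
  qed
  then show ?thesis using tau4_eq_0[OF n] by blast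
qed

text \<open>All slices are multiples of \<open>g\<close>, hence so are all vectors of all
  decompositions. The ratio of \<tau>_3 to the squared norm is constant on multiples of
  \<open>g\<close>, but need not be 0.\<close>

lemma tau4_product_S:
  assumes n: "norm \<psi> = 1" and p: "\<And>a b c s. \<psi> $ (a, b, c, s) = f s * g $ (a, b, c)"
  shows "tau4 \<psi> = 0"
proof -
  obtain x0 where g0: "g $ x0 \<noteq> 0"
    using state4_nonzero[OF n] p by (metis mult_zero_right)
  then have "g \<noteq> 0" by auto
  have p': "slice \<psi> s $ x = f s * g $ x" for s x
    by (cases x) (simp add: p)
  have "tau3_pure v = tau3_pure g / (norm g)\<^sup>2 * (norm v)\<^sup>2"
    if "\<And>x y \<alpha> \<beta>. (\<And>s. \<alpha> * slice \<psi> s $ x = \<beta> * slice \<psi> s $ y) \<Longrightarrow> \<alpha> * v $ x = \<beta> * v $ y" for v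
  proof -
    have "g $ x0 * v $ x = g $ x * v $ x0" for x
      by (rule that) (simp add: p')
    then have v: "v = (v $ x0 / g $ x0) *s g"
      using g0 by (simp add: vec_eq_iff field_simps)
    have "norm (k *s g) = cmod k * norm g" for k
      by (simp add: norm_vec_def norm_mult L2_set_right_distrib)
    then show ?thesis
      using \<open>g \<noteq> 0\<close> by (subst (1 2) v) (simp add: tau3_pure_scale power_mult_distrib)
  qed
  then show ?thesis using tau4_eq_0[OF n] by blast
qed


section \<open>Exchanging the qubits\<close>

definition swap_AB :: "'n::finite state4 \<Rightarrow> 'n state4" where
  "swap_AB \<psi> = (\<chi> x. case x of (a, b, c, s) \<Rightarrow> \<psi> $ (b, a, c, s))"

definition swap_AC :: "'n::finite state4 \<Rightarrow> 'n state4" where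
  "swap_AC \<psi> = (\<chi> x. case x of (a, b, c, s) \<Rightarrow> \<psi> $ (c, b, a, s))"

lemma swap_nth [simp]:
  "swap_AB \<psi> $ (a, b, c, s) = \<psi> $ (b, a, c, s)"
  "swap_AC \<psi> $ (a, b, c, s) = \<psi> $ (c, b, a, s)"
  by (simp_all add: swap_AB_def swap_AC_def)

lemma swap_scaleR:
  "swap_AB (r *\<^sub>R \<psi>) = r *\<^sub>R swap_AB \<psi>" "swap_AC (r *\<^sub>R \<psi>) = r *\<^sub>R swap_AC \<psi>"
  by (auto simp: vec_eq_iff)

lemma norm_vec_reindex:
  assumes "bij \<sigma>" "\<And>x. w $ x = v $ \<sigma> x"
  shows "norm w = norm (v :: complex ^ 'i)"
  using sum.reindex_bij_betw[OF assms(1), of "\<lambda>x. (cmod (v $ x))\<^sup>2"] assms(2)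
  by (simp add: norm_vec_def L2_set_def)

lemma norm_swap [simp]: "norm (swap_AB \<psi>) = norm \<psi>" "norm (swap_AC \<psi>) = norm \<psi>"
proof -
  show "norm (swap_AB \<psi>) = norm \<psi>"
    by (rule norm_vec_reindex[where \<sigma> = "\<lambda>(a, b, c, s). (b, a, c, s)"])
      (auto intro!: involuntory_imp_bij)
  show "norm (swap_AC \<psi>) = norm \<psi>"
    by (rule norm_vec_reindex[where \<sigma> = "\<lambda>(a, b, c, s). (c, b, a, s)"])
      (auto intro!: involuntory_imp_bij)
qed

text \<open>An exchange of qubits is a linear involution of the slices that preserves the
  hyperdeterminant; results for party A thus carry over to B and C.\<close>

lemma tau4_swap:
  assumes n: "norm \<psi> = 1"
  shows "tau4 (swap_AB \<psi>) = tau4 \<psi>" "tau4 (swap_AC \<psi>) = tau4 \<psi>"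
proof -
  define f where "f v = (\<chi> x. case x of (a, b, c) \<Rightarrow> v $ (b, a, c))" for v :: qubits3
  have "tau3_pure (f v) = 1 * tau3_pure v" for v
    using hdet_swap12[of "\<lambda>i j k. v $ (i, j, k)"] by (simp add: tau3_pure_hdet f_def)
  then have "tau4 (swap_AB \<psi>) = 1 * tau4 \<psi>"
    using n by (intro tau4_linear[of _ _ f f] clinearI) (auto simp: vec_eq_iff f_def)
  then show "tau4 (swap_AB \<psi>) = tau4 \<psi>" by simp
  define g where "g v = (\<chi> x. case x of (a, b, c) \<Rightarrow> v $ (c, b, a))" for v :: qubits3
  have "tau3_pure (g v) = 1 * tau3_pure v" for v
    using hdet_swap13[of "\<lambda>i j k. v $ (i, j, k)"] by (simp add: tau3_pure_hdet g_def)
  then have "tau4 (swap_AC \<psi>) = 1 * tau4 \<psi>"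
    using n by (intro tau4_linear[of _ _ g g] clinearI) (auto simp: vec_eq_iff g_def)
  then show "tau4 (swap_AC \<psi>) = tau4 \<psi>" by simp
qed

theorem tau4_separable:
  assumes n: "norm \<psi> = 1" and s: "separable \<psi>"
  shows "tau4 \<psi> = 0"
  using s unfolding separable_def
proof (elim disjE exE)
  fix f :: "complex ^ 2" and g :: "complex ^ (2 \<times> 2 \<times> 'a)"
  assume "\<forall>a b c s. \<psi> $ (a, b, c, s) = f $ a * g $ (b, c, s)"
  then show ?thesis
    using tau4_product_A[OF n, of "($) f" "\<lambda>b c s. g $ (b, c, s)"] by simp
next
  fix f :: "complex ^ 2" and g :: "complex ^ (2 \<times> 2 \<times> 'a)"
  assume "\<forall>a b c s. \<psi> $ (a, b, c, s) = f $ b * g $ (a, c, s)"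
  then show ?thesis
    using tau4_product_A[of "swap_AB \<psi>" "($) f" "\<lambda>b c s. g $ (b, c, s)"] n tau4_swap(1)[OF n] by simp
next
  fix f :: "complex ^ 2" and g :: "complex ^ (2 \<times> 2 \<times> 'a)"
  assume "\<forall>a b c s. \<psi> $ (a, b, c, s) = f $ c * g $ (a, b, s)"
  then show ?thesis
    using tau4_product_A[of "swap_AC \<psi>" "($) f" "\<lambda>b c s. g $ (c, b, s)"] n tau4_swap(2)[OF n] by simp
next
  fix f :: "complex ^ 'a" and g :: "complex ^ (2 \<times> 2 \<times> 2)"
  assume "\<forall>a b c s. \<psi> $ (a, b, c, s) = f $ s * g $ (a, b, c)"
  then show ?thesis
    using tau4_product_S[OF n, of "($) f" g] by simp
next
  \<comment> \<open>Exchanging A and C turns the cut AB|CS into AS|BC.\<close>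
  fix f :: "complex ^ (2 \<times> 2)" and g :: "complex ^ (2 \<times> 'a)"
  assume "\<forall>a b c s. \<psi> $ (a, b, c, s) = f $ (a, b) * g $ (c, s)"
  then show ?thesis
    using tau4_product_BC[of "swap_AC \<psi>" "\<lambda>a s. g $ (a, s)" "\<lambda>b c. f $ (c, b)"] n tau4_swap(2)[OF n]
    by simp
next
  fix f :: "complex ^ (2 \<times> 2)" and g :: "complex ^ (2 \<times> 'a)"
  assume "\<forall>a b c s. \<psi> $ (a, b, c, s) = f $ (a, c) * g $ (b, s)"
  then show ?thesis
    using tau4_product_BC[of "swap_AB \<psi>" "\<lambda>a s. g $ (a, s)" "\<lambda>b c. f $ (b, c)"] n tau4_swap(1)[OF n]
    by simp
next
  fix f :: "complex ^ (2 \<times> 'a)" and g :: "complex ^ (2 \<times> 2)"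
  assume "\<forall>a b c s. \<psi> $ (a, b, c, s) = f $ (a, s) * g $ (b, c)"
  then show ?thesis
    using tau4_product_BC[OF n, of "\<lambda>a s. f $ (a, s)" "\<lambda>b c. g $ (b, c)"] by simp
qed


section \<open>Measurements of a qubit\<close>

text \<open>The contribution of an unnormalized outcome to the average: its probability times
  \<tau>_4 of the normalized state. It is 0 for the zero vector, in line with
  \<open>ensemble\<close>, which drops such outcomes.\<close>

definition weighted_tau4 :: "'n::finite state4 \<Rightarrow> real" where
  "weighted_tau4 \<phi> = (norm \<phi>)\<^sup>2 * tau4 ((1 / norm \<phi>) *\<^sub>R \<phi>)"

definition det2 :: "complex ^ 2 ^ 2 \<Rightarrow> complex" where
  "det2 K = K $ 0 $ 0 * K $ 1 $ 1 - K $ 0 $ 1 * K $ 1 $ 0"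

lemma act_A_nth [simp]:
  "act_A K \<psi> $ (a, b, c, s) = K $ a $ 0 * \<psi> $ (0, b, c, s) + K $ a $ 1 * \<psi> $ (1, b, c, s)"
  by (simp add: act_A_def sum_UNIV_2)

lemma weighted_tau4_act_A_singular:
  assumes "det2 K = 0"
  shows "weighted_tau4 (act_A K \<psi>) = 0"
proof (cases "act_A K \<psi> = 0")
  case True
  then show ?thesis by (simp add: weighted_tau4_def)
next
  case False
  \<comment> \<open>A singular matrix has rank at most one. The outcome then factors as
    \<open>f\<close> on A times a state of BCS.\<close>
  have "\<exists>f g. \<forall>i j. K $ i $ j = f i * g j"
  proof (cases "K $ 0 = 0")
    case True
    then have "K $ i $ j = (if i = 0 then 0 else 1) * K $ 1 $ j" for i j
      using cases_zero_one[of i] by auto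
    then show ?thesis
      by (intro exI[of _ "\<lambda>i. if i = 0 then 0 else 1"] exI[of _ "($) (K $ 1)"] allI)
  next
    case False
    then obtain j0 where j0: "K $ 0 $ j0 \<noteq> 0" by (auto simp: vec_eq_iff)
    have eq: "K $ i $ j * K $ 0 $ j0 = K $ i $ j0 * K $ 0 $ j" for i j
      using assms cases_zero_one[of i] cases_zero_one[of j] cases_zero_one[of j0]
      by (auto simp: det2_def algebra_simps)
    have "K $ i $ j = K $ i $ j0 / K $ 0 $ j0 * K $ 0 $ j" for i j
      using eq[of i j] j0 by (simp add: nonzero_eq_divide_eq)
    then show ?thesis
      by (intro exI[of _ "\<lambda>i. K $ i $ j0 / K $ 0 $ j0"] exI[of _ "($) (K $ 0)"] allI)
  qed
  then obtain f g where K: "\<And>i j. K $ i $ j = f i * g j" by blast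
  have "tau4 ((1 / norm (act_A K \<psi>)) *\<^sub>R act_A K \<psi>) = 0"
    using False
    by (intro tau4_product_A[of _ f "\<lambda>b c s. (1 / norm (act_A K \<psi>)) *\<^sub>R
          (g 0 * \<psi> $ (0, b, c, s) + g 1 * \<psi> $ (1, b, c, s))"])
      (auto simp: K algebra_simps)
  then show ?thesis by (simp add: weighted_tau4_def)
qed

lemma weighted_tau4_act_A_regular:
  assumes n: "norm \<psi> = 1" and d: "det2 K \<noteq> 0" and nz: "act_A K \<psi> \<noteq> 0"
  shows "weighted_tau4 (act_A K \<psi>) = cmod (det2 K) * tau4 \<psi>"
proof -
  define r where "r = norm (act_A K \<psi>)"
  have r: "r > 0" using nz by (simp add: r_def)
  \<comment> \<open>\<open>f\<close> is the action of \<open>K\<close> on ABC together with the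
    normalization of the outcome.\<close>
  define f where "f v = (1 / r) *\<^sub>R (\<chi> x. case x of (a, b, c) \<Rightarrow>
      K $ a $ 0 * v $ (0, b, c) + K $ a $ 1 * v $ (1, b, c))" for v :: qubits3
  \<comment> \<open>The adjugate of \<open>K\<close>: in the type \<open>2\<close>, the index 1 - i
    is the other label.\<close>
  define N where "N i j = (if i = j then K $ (1 - i) $ (1 - j) else - K $ i $ j)" for i j
  define J where "J i j = N i j / det2 K" for i j
  define g where "g v = r *\<^sub>R (\<chi> x. case x of (a, b, c) \<Rightarrow>
      J a 0 * v $ (0, b, c) + J a 1 * v $ (1, b, c))" for v :: qubits3
  have f_nth: "f v $ (a, b, c) =
      (K $ a $ 0 * v $ (0, b, c) + K $ a $ 1 * v $ (1, b, c)) / complex_of_real r" for v a b c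
    unfolding f_def vector_scaleR_component by (simp add: scaleR_conv_of_real)
  have g_nth: "g v $ (a, b, c) =
      complex_of_real r * (J a 0 * v $ (0, b, c) + J a 1 * v $ (1, b, c))" for v a b c
    unfolding g_def vector_scaleR_component by (simp add: scaleR_conv_of_real)
  have lin: "clinear f" "clinear g"
    by (auto intro!: clinearI simp: vec_eq_iff f_nth g_nth algebra_simps add_divide_distrib)
  have NK: "N i 0 * K $ 0 $ j + N i 1 * K $ 1 $ j = (if i = j then det2 K else 0)"
    "K $ i $ 0 * N 0 j + K $ i $ 1 * N 1 j = (if i = j then det2 K else 0)" for i j
    using cases_zero_one[of i] cases_zero_one[of j]
    by (elim disjE; simp add: N_def det2_def mult.commute)+
  have JK: "J i 0 * K $ 0 $ j + J i 1 * K $ 1 $ j = (if i = j then 1 else 0)"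
    "K $ i $ 0 * J 0 j + K $ i $ 1 * J 1 j = (if i = j then 1 else 0)" for i j
    using NK[of i j] d by (simp_all add: J_def flip: add_divide_distrib)
  have "g (f v) $ (a, b, c) = v $ (a, b, c)" for v a b c
  proof -
    have "g (f v) $ (a, b, c) = (J a 0 * K $ 0 $ 0 + J a 1 * K $ 1 $ 0) * v $ (0, b, c)
        + (J a 0 * K $ 0 $ 1 + J a 1 * K $ 1 $ 1) * v $ (1, b, c)"
      using r by (simp add: f_nth g_nth field_simps)
    then show ?thesis
      using cases_zero_one[of a] by (auto simp: JK)
  qed
  moreover have "f (g v) $ (a, b, c) = v $ (a, b, c)" for v a b c
  proof -
    have "f (g v) $ (a, b, c) = (K $ a $ 0 * J 0 0 + K $ a $ 1 * J 1 0) * v $ (0, b, c)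
        + (K $ a $ 0 * J 0 1 + K $ a $ 1 * J 1 1) * v $ (1, b, c)"
      using r by (simp add: f_nth g_nth field_simps)
    then show ?thesis
      using cases_zero_one[of a] by (auto simp: JK)
  qed
  ultimately have inv: "g (f v) = v" "f (g v) = v" for v
    by (auto simp: vec_eq_iff)
  have "hdet (\<lambda>i j k. (r *\<^sub>R f v) $ (i, j, k)) = (det2 K)\<^sup>2 * hdet (\<lambda>i j k. v $ (i, j, k))" for v
    using hdet_transform[of "\<lambda>i j. K $ i $ j" "\<lambda>i j k. v $ (i, j, k)"] r
    by (simp add: f_def det2_def)
  then have "tau3_pure (r *\<^sub>R f v) = sqrt (cmod ((det2 K)\<^sup>2)) * tau3_pure v" for v
    by (rule tau3_pure_cong)
  then have sc: "tau3_pure (f v) = cmod (det2 K) / r\<^sup>2 * tau3_pure v" for v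
    using r by (simp add: tau3_pure_scaleR norm_power field_simps)
  \<comment> \<open>The probability r^2 of the outcome will cancel the denominator.\<close>
  have "tau4 ((1 / r) *\<^sub>R act_A K \<psi>) = cmod (det2 K) / r\<^sup>2 * tau4 \<psi>"
    by (rule tau4_linear[OF n _ lin inv(2,1) _ sc])
      (use r d in \<open>auto simp: vec_eq_iff f_def r_def\<close>)
  then show ?thesis
    using r by (simp add: weighted_tau4_def flip: r_def)
qed

lemma weighted_tau4_act_A:
  assumes n: "norm \<psi> = 1"
  shows "weighted_tau4 (act_A K \<psi>) \<le> cmod (det2 K) * tau4 \<psi>"
proof (cases "det2 K = 0 \<or> act_A K \<psi> = 0")
  case True
  then have "weighted_tau4 (act_A K \<psi>) = 0"
    using weighted_tau4_act_A_singular by (auto simp: weighted_tau4_def)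
  then show ?thesis using tau4_nonneg[OF n] by simp
next
  case False
  then show ?thesis using weighted_tau4_act_A_regular[OF n] by simp
qed

lemma weighted_tau4_swap:
  "weighted_tau4 (swap_AB \<phi>) = weighted_tau4 \<phi>" "weighted_tau4 (swap_AC \<phi>) = weighted_tau4 \<phi>"
  by (cases "\<phi> = 0"; simp add: weighted_tau4_def tau4_swap flip: swap_scaleR)+

lemma weighted_tau4_act_B:
  assumes "norm \<psi> = 1"
  shows "weighted_tau4 (act_B K \<psi>) \<le> cmod (det2 K) * tau4 \<psi>"
proof -
  have "act_B K \<psi> = swap_AB (act_A K (swap_AB \<psi>))"
    by (auto simp: vec_eq_iff act_B_def sum_UNIV_2)
  then show ?thesis
    using weighted_tau4_act_A[of "swap_AB \<psi>" K] assms by (simp add: weighted_tau4_swap tau4_swap)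
qed

lemma weighted_tau4_act_C:
  assumes "norm \<psi> = 1"
  shows "weighted_tau4 (act_C K \<psi>) \<le> cmod (det2 K) * tau4 \<psi>"
proof -
  have "act_C K \<psi> = swap_AC (act_A K (swap_AC \<psi>))"
    by (auto simp: vec_eq_iff act_C_def sum_UNIV_2)
  then show ?thesis
    using weighted_tau4_act_A[of "swap_AC \<psi>" K] assms by (simp add: weighted_tau4_swap tau4_swap)
qed

text \<open>The arithmetic-geometric mean inequality on the two products in the determinant bounds 2
  |det K| by the trace of K^* K; completeness makes these traces sum to 2, the dimension of a
  qubit.\<close>

lemma sum_cmod_det2_le:
  assumes "kraus_complete Ks"
  shows "(\<Sum>K\<leftarrow>Ks. cmod (det2 K)) \<le> 1"
proof -
  have le: "2 * cmod (det2 K) \<le> Re (trace (dagger K ** K))" for K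
  proof -
    have "cmod (det2 K) \<le> cmod (K $ 0 $ 0) * cmod (K $ 1 $ 1) + cmod (K $ 0 $ 1) * cmod (K $ 1 $ 0)"
      using norm_triangle_ineq4[of "K $ 0 $ 0 * K $ 1 $ 1" "K $ 0 $ 1 * K $ 1 $ 0"]
      by (simp add: det2_def norm_mult)
    moreover have "Re (trace (dagger K ** K)) = (cmod (K $ 0 $ 0))\<^sup>2 + (cmod (K $ 1 $ 1))\<^sup>2
        + ((cmod (K $ 0 $ 1))\<^sup>2 + (cmod (K $ 1 $ 0))\<^sup>2)"
      by (simp add: trace_def dagger_def matrix_matrix_mult_def sum_UNIV_2 cmod_power2)
        (simp add: power2_eq_square)
    moreover have "2 * (x * y) \<le> x\<^sup>2 + y\<^sup>2" for x y :: real
      using sum_squares_bound[of x y] by simp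
    ultimately show ?thesis
      by (smt (verit))
  qed
  have "2 * (\<Sum>K\<leftarrow>Ks. cmod (det2 K)) \<le> Re (trace (\<Sum>K\<leftarrow>Ks. dagger K ** K))"
  proof (induction Ks)
    case Nil
    then show ?case by (simp add: trace_def)
  next
    case (Cons K Ks)
    then show ?case using le[of K] by (simp add: trace_add algebra_simps)
  qed
  also have "\<dots> = 2"
    using assms by (simp add: kraus_complete_def trace_def mat_def)
  finally show ?thesis by simp
qed


section \<open>Measurements of the system S\<close>

text \<open>An operator on S can be moved cyclically under the trace over S, so only K^* K enters,
  and these sum to the identity.\<close>

lemma rho_ABC_act_S:
  assumes "kraus_complete Ks"
  shows "(\<Sum>K\<leftarrow>Ks. rho_ABC (act_S K \<psi>)) = rho_ABC \<psi>"
proof -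
  \<comment> \<open>\<open>G X\<close> is the trace over S of the projector onto \<psi> multiplied
    from the left by \<open>X\<close> on S; it is additive in \<open>X\<close>.\<close>
  define G where "G X = (\<chi> x y. case (x, y) of ((a, b, c), (a', b', c')) \<Rightarrow>
      \<Sum>s\<in>UNIV. \<Sum>t\<in>UNIV. X $ t $ s * \<psi> $ (a, b, c, s) * cnj (\<psi> $ (a', b', c', t)))"
    for X :: "complex ^ 'a ^ 'a"
  have G_add: "G (X + Y) = G X + G Y" for X Y
    by (auto simp: G_def vec_eq_iff algebra_simps sum.distrib)
  have G_0: "G 0 = 0"
    by (auto simp: G_def vec_eq_iff)
  have G_1: "G (mat 1) = rho_ABC \<psi>"
    by (auto simp: G_def vec_eq_iff mat_def rho_ABC_def trace_S_def ket_bra_def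
        if_distrib[of "\<lambda>q. q * _"] cong: if_cong)
  have "rho_ABC (act_S K \<psi>) = G (dagger K ** K)" for K
  proof -
    have "(\<Sum>r\<in>UNIV. (\<Sum>s\<in>UNIV. K $ r $ s * x s) * (\<Sum>t\<in>UNIV. cnj (K $ r $ t) * y t))
      = (\<Sum>s\<in>UNIV. \<Sum>t\<in>UNIV. (\<Sum>r\<in>UNIV. cnj (K $ r $ t) * K $ r $ s) * x s * y t)" for x y :: "'a \<Rightarrow> complex"
    proof -
      have "(\<Sum>r\<in>UNIV. (\<Sum>s\<in>UNIV. K $ r $ s * x s) * (\<Sum>t\<in>UNIV. cnj (K $ r $ t) * y t))
        = (\<Sum>r\<in>UNIV. \<Sum>s\<in>UNIV. \<Sum>t\<in>UNIV. K $ r $ s * x s * (cnj (K $ r $ t) * y t))"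
        by (simp only: sum_product)
      also have "\<dots> = (\<Sum>s\<in>UNIV. \<Sum>t\<in>UNIV. \<Sum>r\<in>UNIV. K $ r $ s * x s * (cnj (K $ r $ t) * y t))"
        by (rule trans[OF sum.swap]) (intro sum.cong refl sum.swap)
      also have "\<dots> = (\<Sum>s\<in>UNIV. \<Sum>t\<in>UNIV. (\<Sum>r\<in>UNIV. cnj (K $ r $ t) * K $ r $ s) * x s * y t)"
        by (simp add: sum_distrib_left sum_distrib_right mult_ac)
      finally show ?thesis .
    qed
    then show ?thesis
      by (auto simp: G_def vec_eq_iff rho_ABC_def trace_S_def ket_bra_def act_S_def
          dagger_def matrix_matrix_mult_def)
  qed
  then have "(\<Sum>K\<leftarrow>Ks. rho_ABC (act_S K \<psi>)) = G (\<Sum>K\<leftarrow>Ks. dagger K ** K)"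
    by (induction Ks) (auto simp: G_add G_0)
  then show ?thesis
    using assms by (simp add: kraus_complete_def G_1)
qed

text \<open>The reversed triangle inequality for the Lorentz norm on the forward cone. Squaring
  reduces it to the reversed Cauchy-Schwarz inequality, whose gap is the square of x w - y
  z.\<close>

lemma reverse_minkowski:
  fixes x y z w :: real
  assumes "0 \<le> y" "y \<le> x" "0 \<le> w" "w \<le> z"
  shows "sqrt (x\<^sup>2 - y\<^sup>2) + sqrt (z\<^sup>2 - w\<^sup>2) \<le> sqrt ((x + z)\<^sup>2 - (y + w)\<^sup>2)"
proof (rule real_le_rsqrt)
  have nn: "0 \<le> x\<^sup>2 - y\<^sup>2" "0 \<le> z\<^sup>2 - w\<^sup>2" "0 \<le> x * z - y * w"
    using assms by (auto simp: power_mono mult_mono)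
  have "sqrt (x\<^sup>2 - y\<^sup>2) * sqrt (z\<^sup>2 - w\<^sup>2) = sqrt ((x\<^sup>2 - y\<^sup>2) * (z\<^sup>2 - w\<^sup>2))"
    by (simp add: real_sqrt_mult)
  also have "\<dots> \<le> x * z - y * w"
  proof (rule real_le_lsqrt)
    have "(x * z - y * w)\<^sup>2 - (x\<^sup>2 - y\<^sup>2) * (z\<^sup>2 - w\<^sup>2) = (x * w - y * z)\<^sup>2"
      by algebra
    then show "(x\<^sup>2 - y\<^sup>2) * (z\<^sup>2 - w\<^sup>2) \<le> (x * z - y * w)\<^sup>2"
      using zero_le_power2[of "x * w - y * z"] by linarith
  qed (use nn in auto)
  finally show "(sqrt (x\<^sup>2 - y\<^sup>2) + sqrt (z\<^sup>2 - w\<^sup>2))\<^sup>2 \<le> (x + z)\<^sup>2 - (y + w)\<^sup>2"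
    using nn(1,2) by (simp add: power2_sum algebra_simps power2_eq_square)
qed

lemma reverse_minkowski_list:
  fixes x y :: "'b \<Rightarrow> real"
  assumes "\<And>i. 0 \<le> y i" "\<And>i. y i \<le> x i"
  shows "(\<Sum>i\<leftarrow>is. sqrt ((x i)\<^sup>2 - (y i)\<^sup>2)) \<le> sqrt ((\<Sum>i\<leftarrow>is. x i)\<^sup>2 - (\<Sum>i\<leftarrow>is. y i)\<^sup>2)"
proof (induction "is")
  case (Cons i "is")
  have "0 \<le> (\<Sum>i\<leftarrow>is. y i)" "(\<Sum>i\<leftarrow>is. y i) \<le> (\<Sum>i\<leftarrow>is. x i)"
    using assms by (auto simp: sum_list_mono intro!: sum_list_nonneg)
  then show ?case
    using reverse_minkowski[of "y i" "x i" "\<Sum>i\<leftarrow>is. y i" "\<Sum>i\<leftarrow>is. x i"] assms Cons by simp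
qed simp

lemma weighted_tau4_act_S:
  assumes n: "norm \<psi> = 1" and Ks: "kraus_complete Ks"
  shows "(\<Sum>K\<leftarrow>Ks. weighted_tau4 (act_S K \<psi>)) \<le> tau4 \<psi>"
proof -
  define r where "r K = norm (act_S K \<psi>)" for K
  define \<rho> where "\<rho> K = rho_ABC ((1 / r K) *\<^sub>R act_S K \<psi>)" for K
  define x where "x K = (r K)\<^sup>2 * tau_a (\<rho> K)" for K
  define y where "y K = (r K)\<^sup>2 * tau3 (\<rho> K)" for K
  have "x K \<in> tangle_sums (rho_ABC (act_S K \<psi>)) \<and> y K \<in> tangle_sums (rho_ABC (act_S K \<psi>))
      \<and> 0 \<le> y K \<and> y K \<le> x K" for K
  proof (cases "act_S K \<psi> = 0")
    \<comment> \<open>An outcome of probability 0 has reduced state 0, which the empty list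
      decomposes.\<close>
    case True
    then have "rho_ABC (act_S K \<psi>) = 0"
      using rho_ABC_scaleR[of 0 "act_S K \<psi>"] by simp
    then show ?thesis
      using True by (simp add: x_def y_def r_def tangle_sums_zero)
  next
    case False
    define \<phi> where "\<phi> = (1 / r K) *\<^sub>R act_S K \<psi>"
    have 1: "norm \<phi> = 1" "\<rho> K = rho_ABC \<phi>"
      using False by (simp_all add: \<phi>_def r_def \<rho>_def)
    have 2: "rho_ABC (act_S K \<psi>) = (r K)\<^sup>2 *\<^sub>R \<rho> K"
      using False by (simp add: \<rho>_def rho_ABC_scaleR r_def power_divide)
    have "tau_a (\<rho> K) \<in> average_tangles (\<rho> K)" "tau3 (\<rho> K) \<in> average_tangles (\<rho> K)"
      "0 \<le> tau3 (\<rho> K)" "tau3 (\<rho> K) \<le> tau_a (\<rho> K)"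
      unfolding 1(2) average_tangles_rho_ABC[OF 1(1)]
      by (intro tau_a_mem tau3_mem tau3_le_tau_a 1(1))+
    then show ?thesis
      unfolding 2 x_def y_def
      by (auto intro!: average_tangles_imp_tangle_sums mult_left_mono)
  qed
  then have xy: "\<And>K. x K \<in> tangle_sums (rho_ABC (act_S K \<psi>))"
    "\<And>K. y K \<in> tangle_sums (rho_ABC (act_S K \<psi>))" "\<And>K. 0 \<le> y K" "\<And>K. y K \<le> x K"
    by auto
  \<comment> \<open>Joining optimal decompositions of the outcomes gives decompositions of the
    original state, so the sums lie between its minimum and maximum.\<close>
  have "(\<Sum>K\<leftarrow>Ks. x K) \<in> tangle_sums (rho_ABC \<psi>)" "(\<Sum>K\<leftarrow>Ks. y K) \<in> tangle_sums (rho_ABC \<psi>)"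
    using tangle_sums_sum_list[of Ks _ "\<lambda>K. rho_ABC (act_S K \<psi>)"] xy(1,2)
    by (simp_all add: rho_ABC_act_S[OF Ks])
  then have bounds: "(\<Sum>K\<leftarrow>Ks. x K) \<le> tau_a (rho_ABC \<psi>)" "tau3 (rho_ABC \<psi>) \<le> (\<Sum>K\<leftarrow>Ks. y K)"
    using tau_a_ge[OF n] tau3_le[OF n] by auto
  have "weighted_tau4 (act_S K \<psi>) = sqrt ((x K)\<^sup>2 - (y K)\<^sup>2)" for K
  proof -
    have "(x K)\<^sup>2 - (y K)\<^sup>2 = ((r K)\<^sup>2)\<^sup>2 * ((tau_a (\<rho> K))\<^sup>2 - (tau3 (\<rho> K))\<^sup>2)"
      by (simp add: x_def y_def power_mult_distrib right_diff_distrib)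
    then show ?thesis
      by (simp only: real_sqrt_mult real_sqrt_abs abs_power2 weighted_tau4_def tau4_def \<rho>_def r_def)
  qed
  then have "(\<Sum>K\<leftarrow>Ks. weighted_tau4 (act_S K \<psi>)) \<le> sqrt ((\<Sum>K\<leftarrow>Ks. x K)\<^sup>2 - (\<Sum>K\<leftarrow>Ks. y K)\<^sup>2)"
    using reverse_minkowski_list[of y x Ks] xy by simp
  also have "\<dots> \<le> tau4 \<psi>"
  proof -
    have "0 \<le> (\<Sum>K\<leftarrow>Ks. x K)"
      using order_trans[OF xy(3,4)] by (auto intro!: sum_list_nonneg)
    then show ?thesis
      unfolding tau4_def using bounds tau3_le_tau_a[OF n]
      by (intro real_sqrt_le_mono diff_mono power_mono) auto
  qed
  finally show ?thesis .
qed


section \<open>Protocols\<close>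

lemma tau4_measurement:
  assumes n: "norm \<psi> = 1" and v: "valid_measurement M"
  shows "(\<Sum>k\<leftarrow>kraus_maps M. weighted_tau4 (k \<psi>)) \<le> tau4 \<psi>"
proof -
  have qubit: "(\<Sum>K\<leftarrow>Ks. weighted_tau4 (act K \<psi>)) \<le> tau4 \<psi>"
    if "kraus_complete Ks" "\<And>K. weighted_tau4 (act K \<psi>) \<le> cmod (det2 K) * tau4 \<psi>" for act Ks
  proof -
    have "(\<Sum>K\<leftarrow>Ks. weighted_tau4 (act K \<psi>)) \<le> (\<Sum>K\<leftarrow>Ks. cmod (det2 K) * tau4 \<psi>)"
      using that(2) by (intro sum_list_mono)
    also have "\<dots> = (\<Sum>K\<leftarrow>Ks. cmod (det2 K)) * tau4 \<psi>"
      by (simp add: sum_list_mult_const)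
    also have "\<dots> \<le> tau4 \<psi>"
      using mult_right_mono[OF sum_cmod_det2_le[OF that(1)] tau4_nonneg[OF n]] by simp
    finally show ?thesis .
  qed
  show ?thesis
    using v qubit[of _ act_A, OF _ weighted_tau4_act_A[OF n]]
      qubit[of _ act_B, OF _ weighted_tau4_act_B[OF n]]
      qubit[of _ act_C, OF _ weighted_tau4_act_C[OF n]] weighted_tau4_act_S[OF n]
    by (cases M) (auto simp: o_def)
qed

text \<open>Induction over the protocol tree: by hypothesis the continuation after outcome j
  averages to at most \<tau>_4 of the normalized outcome, and the bound for a single measurement
  handles the root.\<close>

lemma tau4_monotone:
  assumes "norm \<psi> = 1" "valid_protocol P"
  shows "(\<Sum>(N, \<phi>)\<leftarrow>ensemble P \<psi>. N * tau4 \<phi>) \<le> tau4 \<psi>"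
  using assms
proof (induction P arbitrary: \<psi>)
  case Finish
  then show ?case by simp
next
  case (Step M P)
  let ?k = "kraus_maps M"
  let ?branch = "\<lambda>j. let \<phi> = (?k ! j) \<psi>; p = (norm \<phi>)\<^sup>2 in if p = 0 then []
      else map (\<lambda>(N, \<psi>'). (p * N, \<psi>')) (ensemble (P j) ((1 / sqrt p) *\<^sub>R \<phi>))"
  let ?S = "\<lambda>xs. \<Sum>(N, \<phi>)\<leftarrow>xs. N * tau4 \<phi>"
  have scale: "?S (map (\<lambda>(N, \<psi>'). (p * N, \<psi>')) xs) = p * ?S xs"
    for p and xs :: "(real \<times> 'a state4) list"
    by (induction xs) (auto simp: algebra_simps)
  have concat: "?S (concat xss) = (\<Sum>xs\<leftarrow>xss. ?S xs)" for xss :: "(real \<times> 'a state4) list list"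
    by (induction xss) auto
  have "?S (ensemble (Step M P) \<psi>) = (\<Sum>j\<leftarrow>[0..<length ?k]. ?S (?branch j))"
    by (simp only: ensemble.simps concat map_map o_def)
  also have "\<dots> \<le> (\<Sum>j\<leftarrow>[0..<length ?k]. weighted_tau4 ((?k ! j) \<psi>))"
  proof (rule sum_list_mono)
    fix j assume "j \<in> set [0..<length ?k]"
    then have j: "valid_protocol (P j)"
      using Step.prems(2) by simp
    show "?S (?branch j) \<le> weighted_tau4 ((?k ! j) \<psi>)"
    proof (cases "(?k ! j) \<psi> = 0")
      case True
      then show ?thesis by (simp add: weighted_tau4_def)
    next
      case False
      define \<phi> where "\<phi> = (?k ! j) \<psi>"
      have "?S (ensemble (P j) ((1 / norm \<phi>) *\<^sub>R \<phi>)) \<le> tau4 ((1 / norm \<phi>) *\<^sub>R \<phi>)"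
        using False j by (intro Step.IH) (auto simp: \<phi>_def)
      then show ?thesis
        using False by (simp add: Let_def scale weighted_tau4_def mult_left_mono
            del: map_map flip: \<phi>_def)
    qed
  qed
  also have "\<dots> = (\<Sum>k\<leftarrow>?k. weighted_tau4 (k \<psi>))"
    by (rule arg_cong[of _ _ sum_list], rule nth_equalityI) auto
  also have "\<dots> \<le> tau4 \<psi>"
    using tau4_measurement[OF Step.prems(1)] Step.prems(2) by simp
  finally show ?case .
qed

theorem theorem1:
  fixes \<psi> :: "'n::finite state4"
  assumes "norm \<psi> = 1"
  shows "(\<forall>P. valid_protocol P \<longrightarrow> (\<Sum>(N, \<phi>)\<leftarrow>ensemble P \<psi>. N * tau4 \<phi>) \<le> tau4 \<psi>)
       \<and> (separable \<psi> \<longrightarrow> tau4 \<psi> = 0)"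
  using tau4_monotone[OF assms] tau4_separable[OF assms] by blast

end
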